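(* The number of friezes of type $G_2$ is $9$.
   Context: A frieze of type $\Delta$ is a ring homomorphism from the coefficient-free cluster algebra of type $\Delta$ to $\mathbb{Z}$ sending every cluster variable to a positive integer (equivalently, positive integers $a(j,m)$ satisfying $a(j,m)a(j,m+1)=1+\prod_{j\to i}a(i,m)^{|C_{i,j}|}\prod_{i\to j}a(i,m+1)^{|C_{i,j}|}$ for the Cartan matrix $C$ of type $G_2$ and an acyclic orientation). Type $G_2$ is the folding of $D_4$ by the order-$3$ rotation of its Dynkin diagram. *)

theory Defs
  imports
    "HOL-Library.Poly_Mapping"
    "HOL-Library.FuncSet"
    "HOL-Computational_Algebra.Fraction_Field"
    "HOL-Algebra.Generated_Rings"
    "HOL-Algebra.IntRing"
    "HOL-Algebra.Algebraic_Closure_Type"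
begin

section \<open>Coefficient-free cluster algebras\<close>

text \<open>
  The rank is the cardinality of the finite index type \<open>'i\<close>. The ambient field is the
  field of rational functions over the rationals in the indeterminates \<open>x\<^sub>i\<close>, realised as
  the fraction field of the integer polynomial ring; a monomial is a finitely supported exponent
  vector \<open>'i \<Rightarrow>\<^sub>0 nat\<close>. The linear order on \<open>'i\<close> is only needed for the library's
  proof that the polynomial ring is an integral domain.
\<close>

type_synonym 'i ratfun = "(('i \<Rightarrow>\<^sub>0 nat) \<Rightarrow>\<^sub>0 int) fract"

type_synonym 'i exchange_matrix = "'i \<Rightarrow> 'i \<Rightarrow> int"

type_synonym 'i seed = "('i \<Rightarrow> 'i ratfun) \<times> 'i exchange_matrix"

definition indet :: "'i::linorder \<Rightarrow> 'i ratfun" where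
  "indet i = Fract (Poly_Mapping.single (Poly_Mapping.single i 1) 1) 1"

definition skew_symmetrizable :: "'i exchange_matrix \<Rightarrow> bool" where
  "skew_symmetrizable B \<longleftrightarrow>
     (\<exists>d :: 'i \<Rightarrow> int. (\<forall>i. d i > 0) \<and> (\<forall>i j. d i * B i j = - (d j * B j i)))"

text \<open>
  Since \<open>nat\<close> sends negative integers to \<open>0\<close>, the first product below only involves
  the \<open>i\<close> with \<open>B i k > 0\<close> and the second one only those with \<open>B i k < 0\<close>.
\<close>

definition mutate_cluster ::
  "'i::{finite,linorder} \<Rightarrow> ('i \<Rightarrow> 'i ratfun) \<Rightarrow> 'i exchange_matrix \<Rightarrow> 'i \<Rightarrow> 'i ratfun" where
  "mutate_cluster k x B =
     x(k := ((\<Prod>i\<in>UNIV. x i ^ nat (B i k)) + (\<Prod>i\<in>UNIV. x i ^ nat (- B i k))) / x k)"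

definition mutate_matrix :: "'i \<Rightarrow> 'i exchange_matrix \<Rightarrow> 'i exchange_matrix" where
  "mutate_matrix k B = (\<lambda>i j.
     if i = k \<or> j = k then - B i j
     else B i j + sgn (B i k) * max 0 (B i k * B k j))"

inductive_set seeds :: "'i::{finite,linorder} exchange_matrix \<Rightarrow> 'i seed set"
  for B\<^sub>0 :: "'i::{finite,linorder} exchange_matrix" where
  initial: "(indet, B\<^sub>0) \<in> seeds B\<^sub>0"
| mutate: "(x, B) \<in> seeds B\<^sub>0 \<Longrightarrow> (mutate_cluster k x B, mutate_matrix k B) \<in> seeds B\<^sub>0"

definition cluster_variables ::
  "'i::{finite,linorder} exchange_matrix \<Rightarrow> 'i ratfun set" where
  "cluster_variables B\<^sub>0 = (\<Union>(x, B)\<in>seeds B\<^sub>0. range x)"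

definition cluster_algebra ::
  "'i::{finite,linorder} exchange_matrix \<Rightarrow> 'i ratfun ring" where
  "cluster_algebra B\<^sub>0 = (let F = ring_of_type_algebra :: 'i ratfun ring
     in F\<lparr>carrier := generate_ring F (cluster_variables B\<^sub>0)\<rparr>)"

section \<open>Friezes\<close>

text \<open>
  A frieze is a function on the carrier of the cluster algebra; \<open>extensional\<close> fixes its
  irrelevant values outside the carrier, so that distinct elements of the set below are distinct
  friezes.
\<close>

definition friezes ::
  "'i::{finite,linorder} exchange_matrix \<Rightarrow> ('i ratfun \<Rightarrow> int) set" where
  "friezes B = {h \<in> ring_hom (cluster_algebra B) int_ring \<inter> extensional (carrier (cluster_algebra B)).
     \<forall>z\<in>cluster_variables B. h z > 0}"

section \<open>Type \<open>G\<^sub>2\<close>\<close>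

definition cartan_counterpart :: "'i exchange_matrix \<Rightarrow> 'i \<Rightarrow> 'i \<Rightarrow> int" where
  "cartan_counterpart B i j = (if i = j then 2 else - \<bar>B i j\<bar>)"

text \<open>The labelling of the two simple roots is left open, so both conventions are covered.\<close>

definition cartan_matrix_G2 :: "('i \<Rightarrow> 'i \<Rightarrow> int) \<Rightarrow> bool" where
  "cartan_matrix_G2 C \<longleftrightarrow> (\<exists>p q. p \<noteq> q \<and> UNIV = {p, q} \<and>
     C p p = 2 \<and> C p q = -1 \<and> C q p = -3 \<and> C q q = 2)"

text \<open>
  As in the finite type classification of Fomin and Zelevinsky, the type is read off from the Cartan
  counterpart of the initial exchange matrix \<open>B\<close>; the signs of the entries of \<open>B\<close> are the
  choice of an orientation of the Dynkin diagram.
\<close>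

definition of_type_G2 :: "'i exchange_matrix \<Rightarrow> bool" where
  "of_type_G2 B \<longleftrightarrow> skew_symmetrizable B \<and> cartan_matrix_G2 (cartan_counterpart B)"

end

theory Submission
  imports Defs
begin

text \<open>
  Let \<open>a\<close> and \<open>b\<close> be the values of a frieze at the two initial cluster variables. The two
  exchange relations out of the initial seed force \<open>a dvd b + 1\<close> and \<open>b dvd a ^ 3 + 1\<close>, and
  the exchange relations propagate \<open>(a, b)\<close> to all cluster variables. Conversely, these two
  divisibilities are invariant under mutation, so evaluating rational functions at such a point
  gives positive integers at all cluster variables; neither the Laurent phenomenon nor the
  periodicity of the cluster variables is needed.

  Writing \<open>b = a * m - 1\<close>, the condition becomes \<open>a * m - 1 dvd a ^ 3 + 1\<close>, Problem 4 of the
  IMO 1994. The cofactor has the form \<open>a * l - 1\<close>, so that \<open>a * l * m = a ^ 2 + l + m\<close>, which is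
  symmetric in \<open>l\<close> and \<open>m\<close> and bounds \<open>a\<close> by \<open>5\<close>.
\<close>

section \<open>Evaluation of rational functions at integer points\<close>

definition poly_eval :: "('i::finite \<Rightarrow> int) \<Rightarrow> (('i \<Rightarrow>\<^sub>0 nat) \<Rightarrow>\<^sub>0 int) \<Rightarrow> int" where
  "poly_eval a P =
     (\<Sum>m\<in>Poly_Mapping.keys P. Poly_Mapping.lookup P m * (\<Prod>i\<in>UNIV. a i ^ Poly_Mapping.lookup m i))"

lemma poly_eval_0 [simp]: "poly_eval a 0 = 0"
  by (simp add: poly_eval_def)

lemma poly_eval_single [simp]:
  "poly_eval a (Poly_Mapping.single m c) = c * (\<Prod>i\<in>UNIV. a i ^ Poly_Mapping.lookup m i)"
  by (simp add: poly_eval_def)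

lemma poly_eval_1 [simp]: "poly_eval a 1 = 1"
  by (simp flip: single_one)

lemma poly_eval_indet:
  "poly_eval a (Poly_Mapping.single (Poly_Mapping.single i (Suc 0)) 1) = a i"
proof -
  have "(\<Prod>j\<in>UNIV. a j ^ Poly_Mapping.lookup (Poly_Mapping.single i (Suc 0)) j) =
      (\<Prod>j\<in>UNIV. if i = j then a j else 1)"
    by (intro prod.cong) (auto simp: lookup_single when_def)
  then show ?thesis
    by simp
qed

lemma poly_eval_add: "poly_eval a (P + Q) = poly_eval a P + poly_eval a Q"
  unfolding poly_eval_def
  by (rule setsum_keys_plus_distrib) (simp_all add: distrib_right)

lemma poly_eval_minus: "poly_eval a (- P) = - poly_eval a P"
  using poly_eval_add[of a P "- P"] by simp

lemma poly_eval_diff: "poly_eval a (P - Q) = poly_eval a P - poly_eval a Q"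
  using poly_eval_add[of a P "- Q"] by (simp add: poly_eval_minus)

text \<open>Evaluation is additive and the monomials \<open>frag_of m\<close> generate the
  polynomials as an abelian group, so two inductions reduce the claim to a product of monomials,
  where exponents add.\<close>

lemma poly_eval_mult: "poly_eval a (P * Q) = poly_eval a P * poly_eval a Q"
proof -
  have single: "poly_eval a (frag_of m * Q) = poly_eval a (frag_of m) * poly_eval a Q" for m
  proof -
    have "Poly_Mapping.keys Q \<subseteq> UNIV"
      by simp
    then show ?thesis
      by (induction Q rule: frag_induction)
        (simp_all add: mult_single lookup_add power_add prod.distrib right_diff_distrib poly_eval_diff)
  qed
  have "Poly_Mapping.keys P \<subseteq> UNIV"
    by simp
  then show ?thesis
    by (induction P rule: frag_induction)
      (simp_all only: single left_diff_distrib poly_eval_diff poly_eval_0 mult_zero_left)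
qed

text \<open>
  Only integer values are recorded, so the functions having a value form a subring, but are not
  closed under division by functions with nonzero value.
\<close>

definition has_value :: "('i::{finite,linorder} \<Rightarrow> int) \<Rightarrow> 'i ratfun \<Rightarrow> int \<Rightarrow> bool" where
  "has_value a z r \<longleftrightarrow>
     (\<exists>P Q. z = Fract P Q \<and> poly_eval a Q \<noteq> 0 \<and> poly_eval a P = r * poly_eval a Q)"

lemma has_valueI:
  "poly_eval a Q \<noteq> 0 \<Longrightarrow> poly_eval a P = r * poly_eval a Q \<Longrightarrow> has_value a (Fract P Q) r"
  by (auto simp: has_value_def)

lemma has_valueE:
  assumes "has_value a z r"
  obtains P Q where "z = Fract P Q" "Q \<noteq> 0" "poly_eval a Q \<noteq> 0"
    "poly_eval a P = r * poly_eval a Q"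
  using assms unfolding has_value_def by (metis poly_eval_0)

text \<open>Cross-multiply two fractions for \<open>z\<close> and evaluate; the nonzero denominators
  cancel, so the value does not depend on the representing fraction.\<close>

lemma has_value_unique:
  assumes "has_value a z r" "has_value a z s"
  shows "r = s"
proof -
  obtain P Q where 1: "z = Fract P Q" "Q \<noteq> 0" "poly_eval a Q \<noteq> 0"
      "poly_eval a P = r * poly_eval a Q"
    using assms(1) by (rule has_valueE)
  obtain P' Q' where 2: "z = Fract P' Q'" "Q' \<noteq> 0" "poly_eval a Q' \<noteq> 0"
      "poly_eval a P' = s * poly_eval a Q'"
    using assms(2) by (rule has_valueE)
  have "P * Q' = P' * Q"
    using 1 2 by (simp add: eq_fract)
  then have "poly_eval a P * poly_eval a Q' = poly_eval a P' * poly_eval a Q"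
    by (metis poly_eval_mult)
  then show ?thesis
    using 1 2 by simp
qed

lemma has_value_indet: "has_value a (indet i) (a i)"
  unfolding indet_def by (rule has_valueI) (simp_all del: poly_eval_single add: poly_eval_indet)

lemma has_value_1: "has_value a 1 1"
  unfolding One_fract_def by (rule has_valueI) simp_all

lemma has_value_minus: "has_value a z r \<Longrightarrow> has_value a (- z) (- r)"
  by (elim has_valueE) (auto intro!: has_valueI simp: poly_eval_minus)

lemma has_value_add:
  "has_value a z r \<Longrightarrow> has_value a w s \<Longrightarrow> has_value a (z + w) (r + s)"
  by (elim has_valueE) (auto intro!: has_valueI simp: poly_eval_mult poly_eval_add algebra_simps)

lemma has_value_mult:
  "has_value a z r \<Longrightarrow> has_value a w s \<Longrightarrow> has_value a (z * w) (r * s)"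
  by (elim has_valueE) (auto intro!: has_valueI simp: poly_eval_mult)

lemma has_value_power: "has_value a z r \<Longrightarrow> has_value a (z ^ n) (r ^ n)"
  by (induction n) (auto intro: has_value_1 has_value_mult)

text \<open>The new denominator contains the numerator of \<open>w\<close>, which evaluates to a
  nonzero integer because \<open>s\<close> is nonzero. The form \<open>r * s\<close> encodes exact
  division of the values.\<close>

lemma has_value_divide:
  assumes "has_value a z (r * s)" "has_value a w s" "s \<noteq> 0"
  shows "has_value a (z / w) r"
  using assms(1,2)
  by (elim has_valueE) (auto intro!: has_valueI simp: poly_eval_mult \<open>s \<noteq> 0\<close>)

section \<open>Friezes as functions on the cluster algebra\<close>

lemma cluster_variableI: "(x, B') \<in> seeds B \<Longrightarrow> x k \<in> cluster_variables B"
  by (auto simp: cluster_variables_def)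

lemma indet_cluster_variable: "indet k \<in> cluster_variables B"
  by (rule cluster_variableI[OF seeds.initial])

lemma carrier_cluster_algebra:
  "carrier (cluster_algebra B) = generate_ring ring_of_type_algebra (cluster_variables B)"
  by (simp add: cluster_algebra_def)

lemma a_inv_ring_of_type_algebra:
  "a_inv ring_of_type_algebra z = - (z :: 'a::comm_ring_1)"
proof -
  interpret ring "ring_of_type_algebra :: 'a ring"
    by (rule ring_from_type_algebra)
  show ?thesis
    by (rule minus_equality) (simp_all add: ring_of_type_algebra_def)
qed

lemma cluster_algebra_induct [consumes 1, case_names one incl minus add mult]:
  assumes "z \<in> carrier (cluster_algebra B)" "P 1"
    "\<And>z. z \<in> cluster_variables B \<Longrightarrow> P z"
    "\<And>z. z \<in> carrier (cluster_algebra B) \<Longrightarrow> P z \<Longrightarrow> P (- z)"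
    "\<And>z w. \<lbrakk>z \<in> carrier (cluster_algebra B); P z; w \<in> carrier (cluster_algebra B); P w\<rbrakk> \<Longrightarrow> P (z + w)"
    "\<And>z w. \<lbrakk>z \<in> carrier (cluster_algebra B); P z; w \<in> carrier (cluster_algebra B); P w\<rbrakk> \<Longrightarrow> P (z * w)"
  shows "P z"
  using assms(1) unfolding carrier_cluster_algebra
proof (induction rule: generate_ring.induct)
  case one
  show ?case
    using assms(2) by (simp add: ring_of_type_algebra_def)
next
  case (incl z)
  then show ?case
    by (rule assms(3))
next
  case (a_inv z)
  then show ?case
    using assms(4) by (simp add: a_inv_ring_of_type_algebra carrier_cluster_algebra)
next
  case (eng_add z w)
  then show ?case
    using assms(5) by (simp add: ring_of_type_algebra_def carrier_cluster_algebra)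
next
  case (eng_mult z w)
  then show ?case
    using assms(6) by (simp add: ring_of_type_algebra_def carrier_cluster_algebra)
qed

lemma cluster_algebra_incl: "z \<in> cluster_variables B \<Longrightarrow> z \<in> carrier (cluster_algebra B)"
  unfolding carrier_cluster_algebra by (rule generate_ring.incl)

lemma cluster_algebra_one: "1 \<in> carrier (cluster_algebra B)"
  using generate_ring.one[of ring_of_type_algebra "cluster_variables B"]
  unfolding carrier_cluster_algebra by (simp add: ring_of_type_algebra_def)

lemma cluster_algebra_minus:
  "z \<in> carrier (cluster_algebra B) \<Longrightarrow> - z \<in> carrier (cluster_algebra B)"
  using generate_ring.a_inv[of z ring_of_type_algebra "cluster_variables B"]
  unfolding carrier_cluster_algebra by (simp add: a_inv_ring_of_type_algebra)

lemma cluster_algebra_add: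
  "z \<in> carrier (cluster_algebra B) \<Longrightarrow> w \<in> carrier (cluster_algebra B) \<Longrightarrow>
     z + w \<in> carrier (cluster_algebra B)"
  using generate_ring.eng_add[of z ring_of_type_algebra "cluster_variables B" w]
  unfolding carrier_cluster_algebra by (simp add: ring_of_type_algebra_def)

lemma cluster_algebra_mult:
  "z \<in> carrier (cluster_algebra B) \<Longrightarrow> w \<in> carrier (cluster_algebra B) \<Longrightarrow>
     z * w \<in> carrier (cluster_algebra B)"
  using generate_ring.eng_mult[of z ring_of_type_algebra "cluster_variables B" w]
  unfolding carrier_cluster_algebra by (simp add: ring_of_type_algebra_def)

lemmas cluster_algebra_closed =
  cluster_algebra_incl cluster_algebra_one cluster_algebra_minus cluster_algebra_add
  cluster_algebra_mult

lemma cluster_algebra_power: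
  "z \<in> carrier (cluster_algebra B) \<Longrightarrow> z ^ n \<in> carrier (cluster_algebra B)"
  by (induction n) (auto intro: cluster_algebra_closed)

lemma cluster_algebra_hom_iff:
  "h \<in> ring_hom (cluster_algebra B) int_ring \<longleftrightarrow>
     h 1 = 1 \<and> (\<forall>z\<in>carrier (cluster_algebra B). \<forall>w\<in>carrier (cluster_algebra B).
       h (z + w) = h z + h w \<and> h (z * w) = h z * h w)"
proof -
  have "add (cluster_algebra B) = (+)" "monoid.mult (cluster_algebra B) = (*)"
    "monoid.one (cluster_algebra B) = 1"
    by (simp_all add: cluster_algebra_def ring_of_type_algebra_def fun_eq_iff)
  then show ?thesis
    by (auto simp: ring_hom_def)
qed

section \<open>Arithmetic of a fixed frieze\<close>

context
  fixes B :: "'i::{finite,linorder} exchange_matrix" and h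
  assumes frieze: "h \<in> friezes B"
begin

lemma frieze_one: "h 1 = 1"
  using frieze by (simp add: friezes_def cluster_algebra_hom_iff)

lemma frieze_add:
  "z \<in> carrier (cluster_algebra B) \<Longrightarrow> w \<in> carrier (cluster_algebra B) \<Longrightarrow> h (z + w) = h z + h w"
  using frieze by (simp add: friezes_def cluster_algebra_hom_iff)

lemma frieze_mult:
  "z \<in> carrier (cluster_algebra B) \<Longrightarrow> w \<in> carrier (cluster_algebra B) \<Longrightarrow> h (z * w) = h z * h w"
  using frieze by (simp add: friezes_def cluster_algebra_hom_iff)

text \<open>\<open>ring_hom\<close> prescribes sums, products and the unit only; the value at zero
  follows by cancellation in \<open>h (0 + 0)\<close>.\<close>

lemma frieze_zero: "h 0 = 0"
proof -
  have "0 \<in> carrier (cluster_algebra B)"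
    using cluster_algebra_add[OF cluster_algebra_one cluster_algebra_minus[OF cluster_algebra_one]]
    by simp
  then show ?thesis
    using frieze_add[of 0 0] by simp
qed

lemma frieze_minus: "z \<in> carrier (cluster_algebra B) \<Longrightarrow> h (- z) = - h z"
  using frieze_add[of z "- z"] cluster_algebra_minus[of z B] by (simp add: frieze_zero)

lemma frieze_power: "z \<in> carrier (cluster_algebra B) \<Longrightarrow> h (z ^ n) = h z ^ n"
  by (induction n) (simp_all add: frieze_one frieze_mult cluster_algebra_power)

lemma frieze_pos: "z \<in> cluster_variables B \<Longrightarrow> h z > 0"
  using frieze by (simp add: friezes_def)

text \<open>Turns an exchange relation, written as a quotient of rational functions, into an
  equation of integers. The denominator is nonzero because the frieze is positive there.\<close>

lemma frieze_divide:
  assumes "z / w \<in> cluster_variables B" "w \<in> cluster_variables B"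
  shows "h (z / w) * h w = h z"
proof -
  have "w \<noteq> 0"
    using frieze_pos[OF assms(2)] frieze_zero by auto
  then show ?thesis
    using frieze_mult[of "z / w" w] assms by (simp add: cluster_algebra_incl)
qed

end

lemma frieze_eqI:
  assumes h: "h \<in> friezes B" and g: "g \<in> friezes B"
    and eq: "\<And>z. z \<in> cluster_variables B \<Longrightarrow> h z = g z"
  shows "h = g"
proof (rule extensionalityI)
  show "h \<in> extensional (carrier (cluster_algebra B))" "g \<in> extensional (carrier (cluster_algebra B))"
    using h g by (simp_all add: friezes_def)
  show "h z = g z" if "z \<in> carrier (cluster_algebra B)" for z
    using that
    by (induction rule: cluster_algebra_induct)
      (simp_all add: eq frieze_one[OF h] frieze_one[OF g] frieze_minus[OF h] frieze_minus[OF g]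
        frieze_add[OF h] frieze_add[OF g] frieze_mult[OF h] frieze_mult[OF g])
qed

section \<open>The divisibility problem\<close>

text \<open>The coordinates stand for the values at \<open>indet q\<close> and
  \<open>indet p\<close>, in this order.\<close>

definition g2_points :: "(int \<times> int) set" where
  "g2_points = {(a, b). 0 < a \<and> 0 < b \<and> a dvd b + 1 \<and> b dvd a ^ 3 + 1}"

lemma g2_points_coprime: "(a, b) \<in> g2_points \<Longrightarrow> coprime a b"
proof (rule coprimeI)
  fix d assume "(a, b) \<in> g2_points" "d dvd a" "d dvd b"
  then have "d dvd b + 1"
    by (auto simp: g2_points_def)
  then show "is_unit d"
    using \<open>d dvd b\<close> dvd_add_right_iff by blast
qed

text \<open>Since \<open>a * r = b + 1\<close> is 1 modulo \<open>b\<close>,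
  \<open>a ^ 3 * (r ^ 3 + 1)\<close> is \<open>a ^ 3 + 1\<close>, hence 0, modulo \<open>b\<close>,
  and \<open>a\<close> is a unit modulo \<open>b\<close>.\<close>

lemma g2_points_mutate_fst:
  assumes "(a, b) \<in> g2_points"
  shows "\<exists>r. b + 1 = r * a \<and> (r, b) \<in> g2_points"
proof -
  obtain r where r: "b + 1 = a * r"
    using assms by (auto simp: g2_points_def)
  have ab: "0 < a" "0 < b" "b dvd a ^ 3 + 1"
    using assms by (auto simp: g2_points_def)
  have "0 < a * r"
    using r ab by linarith
  then have "0 < r"
    using ab(1) by (simp add: zero_less_mult_iff)
  have "a ^ 3 * (r ^ 3 + 1) = (a * r) ^ 3 + a ^ 3"
    by (simp add: algebra_simps power_mult_distrib)
  also have "\<dots> = b * (b ^ 2 + 3 * b + 3) + (a ^ 3 + 1)"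
    unfolding r[symmetric] by (simp add: algebra_simps power2_eq_square power3_eq_cube)
  finally have "b dvd a ^ 3 * (r ^ 3 + 1)"
    using ab(3) by simp
  moreover have "coprime b (a ^ 3)"
    using g2_points_coprime[OF assms] by (simp add: ac_simps)
  ultimately have "b dvd r ^ 3 + 1"
    by (simp add: coprime_dvd_mult_right_iff)
  then show ?thesis
    using r ab(2) \<open>0 < r\<close> by (intro exI[of _ r]) (simp add: g2_points_def mult.commute)
qed

text \<open>Modulo \<open>a\<close>, \<open>b * r\<close> is 1, so \<open>b * (r + 1)\<close> is
  \<open>b + 1\<close>, hence 0, and \<open>b\<close> is a unit.\<close>

lemma g2_points_mutate_snd:
  assumes "(a, b) \<in> g2_points"
  shows "\<exists>r. a ^ 3 + 1 = r * b \<and> (a, r) \<in> g2_points"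
proof -
  obtain r where r: "a ^ 3 + 1 = b * r"
    using assms by (auto simp: g2_points_def)
  have ab: "0 < a" "0 < b" "a dvd b + 1"
    using assms by (auto simp: g2_points_def)
  have "0 < a ^ 3"
    using ab(1) by simp
  then have "0 < b * r"
    using r by linarith
  then have "0 < r"
    using ab(2) by (simp add: zero_less_mult_iff)
  have "b * (r + 1) = a * a ^ 2 + (b + 1)"
    using r by (simp add: algebra_simps power2_eq_square power3_eq_cube)
  then have "a dvd b * (r + 1)"
    using ab(3) by simp
  then have "a dvd r + 1"
    using g2_points_coprime[OF assms] by (simp add: coprime_dvd_mult_right_iff)
  then show ?thesis
    using r ab(1) \<open>0 < r\<close> by (intro exI[of _ r]) (simp add: g2_points_def mult.commute)
qed

text \<open>The equation makes \<open>a * m - 1\<close> a divisor of \<open>m ^ 2 + a\<close>. For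
  \<open>m = 1\<close> and \<open>m = 2\<close> it then divides 2 and 9 respectively, and 9 is what
  permits \<open>a = 5\<close>; for larger \<open>m\<close> size estimates suffice.\<close>

lemma g2_diophantine_bound:
  fixes a l m :: int
  assumes "0 < a" "0 < m" "m \<le> l" and eq: "a * l * m = a ^ 2 + l + m"
  shows "a \<le> 5"
proof (rule ccontr)
  assume "\<not> a \<le> 5"
  then have a: "6 \<le> a"
    by simp
  \<comment> \<open>The equation reads \<open>l * (a * m - 1) = a ^ 2 + m\<close>; multiplying by
    \<open>m\<close> and subtracting \<open>a * (a * m - 1)\<close> leaves \<open>m ^ 2 + a\<close>,
    with cofactor \<open>m * l - a\<close>.\<close>
  have "(a * m - 1) * (m * l - a) = m * (a * l * m) - a ^ 2 * m - m * l + a"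
    by (simp add: algebra_simps power2_eq_square)
  also have "\<dots> = m ^ 2 + a"
    unfolding eq by (simp add: algebra_simps power2_eq_square)
  finally have "(a * m - 1) * (m * l - a) = m ^ 2 + a" .
  then have dvd: "a * m - 1 dvd m ^ 2 + a"
    by (metis dvd_triv_left)
  consider "m = 1" | "m = 2" | "m \<ge> 3"
    using assms(2) by linarith
  then show False
  proof cases
    case 1
    then have "a - 1 dvd (a - 1) + 2"
      using dvd by (simp add: add.commute)
    then have "a - 1 dvd 2"
      by (metis dvd_add_right_iff dvd_refl)
    then show False
      using zdvd_imp_le[of "a - 1" 2] a by simp
  next
    case 2
    then have "2 * a - 1 dvd 2 * (a + 4)"
      using dvd by (intro dvd_mult) (simp add: ac_simps)
    also have "2 * (a + 4) = (2 * a - 1) + 9"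
      by simp
    finally have "2 * a - 1 dvd 9"
      by (metis dvd_add_right_iff dvd_refl)
    then show False
      using zdvd_imp_le[of "2 * a - 1" 9] a by simp
  next
    case 3
    \<comment> \<open>This gives \<open>a ^ 2 * m - a \<le> a * m ^ 2 + a ^ 2\<close>, while
      \<open>m \<le> l\<close> gives \<open>a * m ^ 2 \<le> a ^ 2 + 2 * m\<close>; eliminating
      \<open>a * m ^ 2\<close> leaves a bound that fails for \<open>6 \<le> a\<close>.\<close>
    have "a * m - 1 \<le> m ^ 2 + a"
      using dvd a 3 by (intro zdvd_imp_le) (auto intro: add_nonneg_pos)
    then have "a * (a * m - 1) \<le> a * (m ^ 2 + a)"
      using a by (intro mult_left_mono) simp_all
    moreover have "1 \<le> a * m"
      using mult_mono[of 1 a 1 m] a 3 by simp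
    then have "m * (a * m - 1) \<le> l * (a * m - 1)"
      using assms(3) by (intro mult_right_mono) simp_all
    ultimately have "(a ^ 2 - 2) * (m - 2) \<le> a + 4"
      using eq by (simp add: algebra_simps power2_eq_square)
    moreover have sq: "6 * a \<le> a ^ 2"
      using a by (simp add: power2_eq_square)
    have "(a ^ 2 - 2) * 1 \<le> (a ^ 2 - 2) * (m - 2)"
      using sq a 3 by (intro mult_left_mono) linarith+
    ultimately have "(a ^ 2 - 2) * 1 \<le> a + 4"
      by (rule order_trans[rotated])
    then show False
      using sq a by simp
  qed
qed

text \<open>The cofactor \<open>c\<close> of \<open>b\<close> also forms a point with
  \<open>a\<close>, so \<open>b\<close> and \<open>c\<close> are both -1 modulo \<open>a\<close>.
  This yields the symmetric equation, and swapping \<open>l\<close> and \<open>m\<close> covers both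
  orders.\<close>

lemma g2_points_fst_le:
  assumes "(a, b) \<in> g2_points"
  shows "a \<le> 5"
proof -
  obtain c where c: "a ^ 3 + 1 = c * b" "(a, c) \<in> g2_points"
    using g2_points_mutate_snd[OF assms] by blast
  have pos: "0 < a" "0 < b" "0 < c"
    using assms c(2) by (auto simp: g2_points_def)
  have "a dvd b + 1" "a dvd c + 1"
    using assms c(2) by (simp_all add: g2_points_def)
  then obtain l m where lm: "b + 1 = a * m" "c + 1 = a * l"
    by (auto elim!: dvdE)
  have "0 < a * m" "0 < a * l"
    using lm pos by linarith+
  then have pos': "0 < m" "0 < l"
    using pos(1) by (simp_all add: zero_less_mult_iff)
  have "b = a * m - 1" "c = a * l - 1"
    using lm by simp_all
  then have "a ^ 3 + 1 = (a * l - 1) * (a * m - 1)"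
    using c(1) by simp
  then have "a * (a * l * m) = a * (a ^ 2 + l + m)"
    by (simp add: algebra_simps power2_eq_square power3_eq_cube)
  then have eq: "a * l * m = a ^ 2 + l + m"
    using pos(1) by simp
  show ?thesis
  proof (cases "m \<le> l")
    case True
    then show ?thesis
      using g2_diophantine_bound eq pos(1) pos'(1) by blast
  next
    case False
    have "a * m * l = a * l * m"
      by simp
    then have "a * m * l = a ^ 2 + m + l"
      using eq by linarith
    then show ?thesis
      using g2_diophantine_bound False pos(1) pos'(2) by force
  qed
qed

lemma g2_points_eq:
  "g2_points = {(1, 1), (1, 2), (2, 1), (2, 3), (2, 9), (3, 2), (3, 14), (5, 9), (5, 14)}"
    (is "_ = ?S")
proof
  \<comment> \<open>The search is complete: \<open>b\<close> divides the positive number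
    \<open>a ^ 3 + 1\<close>, hence is at most that number.\<close>
  have all: "\<forall>a\<in>set [1..5]. \<forall>b\<in>set [1..a ^ 3 + 1].
      a dvd b + 1 \<longrightarrow> b dvd a ^ 3 + 1 \<longrightarrow> (a, b) \<in> ?S"
    by code_simp
  show "g2_points \<subseteq> ?S"
  proof
    fix z assume z: "z \<in> g2_points"
    obtain a b where ab: "z = (a, b)" "0 < a" "0 < b" "a dvd b + 1" "b dvd a ^ 3 + 1"
      using z by (auto simp: g2_points_def)
    have "a \<in> set [1..5]" "b \<in> set [1..a ^ 3 + 1]"
      using ab g2_points_fst_le[of a b] z zdvd_imp_le[of b "a ^ 3 + 1"] by auto
    then show "z \<in> ?S"
      using all ab(1,4,5) by blast
  qed
  show "?S \<subseteq> g2_points"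
    by (simp add: g2_points_def)
qed

lemma card_g2_points: "card g2_points = 9"
  by (simp add: g2_points_eq)

section \<open>Exchange relations\<close>

locale g2_labels =
  fixes p q :: "'i::{finite,linorder}"
  assumes neq: "p \<noteq> q" and UNIV_eq: "UNIV = {p, q}"
begin

text \<open>The two sign patterns are the two orientations. Cluster mutation reads columns, so the
  entry of size 3 in column \<open>p\<close> puts the cube of \<open>x q\<close> into the exchange
  at \<open>p\<close>.\<close>

definition g2_matrix :: "'i exchange_matrix \<Rightarrow> bool" where
  "g2_matrix B \<longleftrightarrow> B p p = 0 \<and> B q q = 0 \<and>
     (B p q = 1 \<and> B q p = -3 \<or> B p q = -1 \<and> B q p = 3)"

lemma label_cases: "k = p \<or> k = q"
  using UNIV_eq by auto

lemma mutate_cluster_p: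
  "g2_matrix B \<Longrightarrow> mutate_cluster p x B = x(p := (x q ^ 3 + 1) / x p)"
  using neq by (auto simp: g2_matrix_def mutate_cluster_def UNIV_eq)

lemma mutate_cluster_q:
  "g2_matrix B \<Longrightarrow> mutate_cluster q x B = x(q := (x p + 1) / x q)"
  using neq by (auto simp: g2_matrix_def mutate_cluster_def UNIV_eq)

text \<open>The off-diagonal entries change sign. As their signs are opposite, the
  \<open>max\<close> term adds 0 to the diagonal entry away from \<open>k\<close>.\<close>

lemma g2_matrix_mutate: "g2_matrix B \<Longrightarrow> g2_matrix (mutate_matrix k B)"
  using neq label_cases[of k] by (auto simp: g2_matrix_def mutate_matrix_def)

lemma g2_matrix_seed: "(x, B') \<in> seeds B \<Longrightarrow> g2_matrix B \<Longrightarrow> g2_matrix B'"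
  by (induction rule: seeds.induct) (auto intro: g2_matrix_mutate)

text \<open>The values on each seed again form a point of \<open>g2_points\<close>, so the next
  exchange divides exactly and gives a positive integer.\<close>

lemma value_seed:
  assumes "(x, B') \<in> seeds B" "g2_matrix B" "(a q, a p) \<in> g2_points"
  shows "\<exists>c. (c q, c p) \<in> g2_points \<and> (\<forall>k. has_value a (x k) (c k))"
  using assms(1)
proof (induction rule: seeds.induct)
  case initial
  show ?case
    using assms(3) has_value_indet by blast
next
  case (mutate x B' k)
  obtain c where c: "(c q, c p) \<in> g2_points" "\<And>k. has_value a (x k) (c k)"
    using mutate.IH by blast
  have B': "g2_matrix B'"
    using mutate.hyps assms(2) by (rule g2_matrix_seed)
  have pos: "c q > 0" "c p > 0"
    using c(1) by (auto simp: g2_points_def)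
  consider "k = p" | "k = q"
    using label_cases by blast
  then show ?case
  proof cases
    case 1
    obtain r where r: "c q ^ 3 + 1 = r * c p" "(c q, r) \<in> g2_points"
      using g2_points_mutate_snd[OF c(1)] by blast
    have "has_value a ((x q ^ 3 + 1) / x p) r"
      using pos r(1)[symmetric] c(2)
      by (intro has_value_divide[where s = "c p"])
        (auto intro!: has_value_add has_value_power has_value_1)
    then show ?thesis
      using neq r(2) c(2) by (intro exI[of _ "c(p := r)"]) (simp add: mutate_cluster_p[OF B'] 1)
  next
    case 2
    obtain r where r: "c p + 1 = r * c q" "(r, c p) \<in> g2_points"
      using g2_points_mutate_fst[OF c(1)] by blast
    have "has_value a ((x p + 1) / x q) r"
      using pos r(1)[symmetric] c(2)
      by (intro has_value_divide[where s = "c q"]) (auto intro!: has_value_add has_value_1)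
    then show ?thesis
      using neq r(2) c(2) by (intro exI[of _ "c(q := r)"]) (simp add: mutate_cluster_q[OF B'] 2)
  qed
qed

lemma value_cluster_variable:
  assumes "z \<in> cluster_variables B" "g2_matrix B" "(a q, a p) \<in> g2_points"
  shows "\<exists>r>0. has_value a z r"
proof -
  obtain x B' k where "(x, B') \<in> seeds B" "z = x k"
    using assms(1) by (auto simp: cluster_variables_def)
  then obtain c where "(c q, c p) \<in> g2_points" "has_value a z (c k)"
    using value_seed assms(2,3) by blast
  moreover from this have "c k > 0"
    using label_cases[of k] by (auto simp: g2_points_def)
  ultimately show ?thesis
    by blast
qed

lemma frieze_exists:
  assumes "g2_matrix B" "(a, b) \<in> g2_points"
  shows "\<exists>h\<in>friezes B. h (indet q) = a \<and> h (indet p) = b"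
proof -
  define c where "c = (\<lambda>k. if k = q then a else b)"
  have c: "c q = a" "c p = b" "(c q, c p) \<in> g2_points"
    using neq assms(2) by (simp_all add: c_def)
  \<comment> \<open>Values are unique where they exist, so \<open>THE\<close> picks the evaluation
    at \<open>c\<close>; \<open>restrict\<close> supplies extensionality.\<close>
  define h where "h = restrict (\<lambda>z. THE r. has_value c z r) (carrier (cluster_algebra B))"
  have h_eq: "h z = r" if "z \<in> carrier (cluster_algebra B)" "has_value c z r" for z r
    using that by (auto simp: h_def intro: has_value_unique)
  have ex: "\<exists>r. has_value c z r" if "z \<in> carrier (cluster_algebra B)" for z
    using that
  proof (induction rule: cluster_algebra_induct)
    case (incl z)
    then show ?case
      using value_cluster_variable[OF _ assms(1) c(3)] by blast
  qed (blast intro: has_value_1 has_value_minus has_value_add has_value_mult)+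
  have "h \<in> ring_hom (cluster_algebra B) int_ring"
    unfolding cluster_algebra_hom_iff
  proof (intro conjI ballI)
    show "h 1 = 1"
      by (intro h_eq has_value_1 cluster_algebra_one)
  next
    fix z w assume zw: "z \<in> carrier (cluster_algebra B)" "w \<in> carrier (cluster_algebra B)"
    then obtain r s where "has_value c z r" "has_value c w s"
      using ex by blast
    with zw show "h (z + w) = h z + h w" "h (z * w) = h z * h w"
      by (simp_all add: h_eq cluster_algebra_closed has_value_add has_value_mult)
  qed
  moreover have "h \<in> extensional (carrier (cluster_algebra B))"
    by (simp add: h_def)
  moreover have "h z > 0" if "z \<in> cluster_variables B" for z
    using value_cluster_variable[OF that assms(1) c(3)] h_eq cluster_algebra_incl[OF that]
    by auto
  ultimately have "h \<in> friezes B"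
    by (simp add: friezes_def)
  moreover have "h (indet k) = c k" for k
    by (intro h_eq has_value_indet cluster_algebra_incl indet_cluster_variable)
  ultimately show ?thesis
    using c(1,2) by metis
qed

text \<open>The divisibilities express integrality at the two cluster variables one mutation away
  from the initial seed.\<close>

lemma frieze_point:
  assumes "g2_matrix B" "h \<in> friezes B"
  shows "(h (indet q), h (indet p)) \<in> g2_points"
proof -
  have "(indet(p := (indet q ^ 3 + 1) / indet p), mutate_matrix p B) \<in> seeds B"
    using seeds.mutate[OF seeds.initial, of p B] assms(1) by (simp add: mutate_cluster_p)
  then have 1: "(indet q ^ 3 + 1) / indet p \<in> cluster_variables B"
    by (metis cluster_variableI fun_upd_same)
  have "(indet(q := (indet p + 1) / indet q), mutate_matrix q B) \<in> seeds B"
    using seeds.mutate[OF seeds.initial, of q B] assms(1) by (simp add: mutate_cluster_q)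
  then have 2: "(indet p + 1) / indet q \<in> cluster_variables B"
    by (metis cluster_variableI fun_upd_same)
  note simps = frieze_one[OF assms(2)] frieze_add[OF assms(2)] frieze_power[OF assms(2)]
    cluster_algebra_closed cluster_algebra_power indet_cluster_variable
  have "h (indet q) dvd h (indet p) + 1"
    using frieze_divide[OF assms(2) 2 indet_cluster_variable] by (simp add: simps) (metis dvd_triv_right)
  moreover have "h (indet p) dvd h (indet q) ^ 3 + 1"
    using frieze_divide[OF assms(2) 1 indet_cluster_variable] by (simp add: simps) (metis dvd_triv_right)
  ultimately show ?thesis
    using frieze_pos[OF assms(2) indet_cluster_variable] by (simp add: g2_points_def)
qed

text \<open>Along mutations, the exchange relation determines the new value, because the value at
  the replaced variable is positive and cancels.\<close>

lemma frieze_determined: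
  assumes "g2_matrix B" and h: "h \<in> friezes B" and g: "g \<in> friezes B"
    and eq: "h (indet q) = g (indet q)" "h (indet p) = g (indet p)"
  shows "h = g"
proof -
  have seed: "\<forall>k. h (x k) = g (x k)" if "(x, B') \<in> seeds B" for x B'
    using that
  proof (induction rule: seeds.induct)
    case initial
    show ?case
      using eq label_cases by metis
  next
    case (mutate x B' k)
    have B': "g2_matrix B'"
      using mutate.hyps assms(1) by (rule g2_matrix_seed)
    have x: "x k \<in> cluster_variables B" for k
      using mutate.hyps by (rule cluster_variableI)
    define z where "z = mutate_cluster k x B' k"
    have z: "z \<in> cluster_variables B"
      unfolding z_def by (rule cluster_variableI[OF seeds.mutate[OF mutate.hyps]])
    have mutate_cluster: "mutate_cluster k x B' = x(k := z)"
      by (simp add: z_def mutate_cluster_def)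
    \<comment> \<open>The exchange numerator involves only the variable that stays in the cluster,
      so both friezes agree on it by induction.\<close>
    define y where "y = (if k = p then x q ^ 3 + 1 else x p + 1)"
    have zy: "z = y / x k"
      using label_cases[of k] neq mutate_cluster_p[OF B'] mutate_cluster_q[OF B']
      by (auto simp: z_def y_def)
    have "h y = g y"
      using mutate.IH
      by (simp add: y_def frieze_one[OF h] frieze_one[OF g] frieze_add[OF h] frieze_add[OF g]
          frieze_power[OF h] frieze_power[OF g] cluster_algebra_closed cluster_algebra_power x)
    then have "h z * h (x k) = g z * h (x k)"
      using frieze_divide[OF h z[unfolded zy] x] frieze_divide[OF g z[unfolded zy] x] mutate.IH
      by (simp add: zy)
    moreover have "h (x k) > 0"
      by (rule frieze_pos[OF h x])
    ultimately show ?case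
      using mutate.IH by (simp add: mutate_cluster)
  qed
  show ?thesis
  proof (rule frieze_eqI[OF h g])
    fix z assume "z \<in> cluster_variables B"
    then show "h z = g z"
      using seed by (auto simp: cluster_variables_def)
  qed
qed

lemma bij_betw_friezes:
  assumes "g2_matrix B"
  shows "bij_betw (\<lambda>h. (h (indet q), h (indet p))) (friezes B) g2_points"
  unfolding bij_betw_def
proof
  show "inj_on (\<lambda>h. (h (indet q), h (indet p))) (friezes B)"
    using frieze_determined[OF assms] by (auto intro: inj_onI)
  show "(\<lambda>h. (h (indet q), h (indet p))) ` friezes B = g2_points"
  proof
    show "(\<lambda>h. (h (indet q), h (indet p))) ` friezes B \<subseteq> g2_points"
      using frieze_point[OF assms] by auto
    show "g2_points \<subseteq> (\<lambda>h. (h (indet q), h (indet p))) ` friezes B"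
      using frieze_exists[OF assms] by (force simp: image_iff)
  qed
qed

end

section \<open>Sign patterns of exchange matrices of type \<open>G2\<close>, and the count\<close>

text \<open>The Cartan counterpart fixes absolute values off the diagonal only; the symmetrizer
  \<open>d\<close> makes the diagonal vanish and the off-diagonal signs opposite.\<close>

lemma of_type_G2_cases:
  fixes B :: "'i::{finite,linorder} exchange_matrix"
  assumes "of_type_G2 B"
  obtains p q where "g2_labels p q" "g2_labels.g2_matrix p q B"
proof -
  obtain p q :: 'i where pq: "p \<noteq> q" "UNIV = {p, q}" "\<bar>B p q\<bar> = 1" "\<bar>B q p\<bar> = 3"
    using assms by (auto simp: of_type_G2_def cartan_matrix_G2_def cartan_counterpart_def)
  obtain d :: "'i \<Rightarrow> int" where d: "\<And>i. d i > 0" "\<And>i j. d i * B i j = - (d j * B j i)"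
    using assms by (auto simp: of_type_G2_def skew_symmetrizable_def)
  interpret g2_labels p q
    using pq by unfold_locales
  have diag: "B i i = 0" for i
    using d(1)[of i] d(2)[of i i] by simp
  have "\<not> (0 < B p q \<and> 0 < B q p)" "\<not> (B p q < 0 \<and> B q p < 0)"
    using mult_pos_pos[of "d p" "B p q"] mult_pos_pos[of "d q" "B q p"]
      mult_pos_neg[of "d p" "B p q"] mult_pos_neg[of "d q" "B q p"]
      d(1)[of p] d(1)[of q] d(2)[of p q] by linarith+
  then have "g2_matrix B"
    using pq(3,4) diag[of p] diag[of q] unfolding g2_matrix_def by linarith
  then show ?thesis
    using that g2_labels_axioms by blast
qed

theorem theorem3p4:
  fixes B :: "'i::{finite,linorder} exchange_matrix"
  assumes "of_type_G2 B"
  shows "card (friezes B) = 9"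
proof -
  obtain p q where "g2_labels p q" "g2_labels.g2_matrix p q B"
    using assms by (rule of_type_G2_cases)
  then show ?thesis
    using bij_betw_same_card[OF g2_labels.bij_betw_friezes] card_g2_points by metis
qed

end
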